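(* Let an instance of \textsc{L-Sided Pricing} be given, let $p^*$ be an optimal pricing, and let $p$ be a pricing that is locally optimal, i.e. $\mathrm{val}(p')\le\mathrm{val}(p)$ for every pricing $p'$ with $\mathrm{HW}(p,p')=1$. Then $\mathrm{val}(p)\ge\mathrm{val}(p^* )/2$.
   Context: An instance of \textsc{L-Sided Pricing} consists of a finite bipartite graph $G=(L\cup R,E)$ (parallel edges allowed, no loops; each edge joins $L$ and $R$), a capacity $\mu_w\in\mathbb Z_{\ge 0}\cup\{\infty\}$ for every vertex $w$, and a budget $b_e\ge 0$ for every edge $e$. For $u\in L$ let $P_u=\{b_e: e\in E\text{ incident to }u\}$. A pricing is a function $p$ on $L$ with $p(u)\in P_u$ for every $u\in L$, extended by $p(v)=0$ for $v\in R$. For a pricing $p$, $\mathrm{val}(p)$ is the maximum of $\sum_{e=uv\in F}(p(u)+p(v))$ over all $F\subseteq E$ such that $p(u)+p(v)\le b_e$ for every $e=uv\in F$ and every vertex $w$ is incident to at most $\mu_w$ edges of $F$. An optimal pricing is a pricing maximizing $\mathrm{val}$. For pricings $p,p'$, $\mathrm{HW}(p,p')=|\{u\in L: p(u)\ne p'(u)\}|$. *)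

theory Defs
  imports Complex_Main "HOL-Library.Extended_Nat"
begin

text \<open>
  Edges are abstract objects with an endpoint in each side, so that parallel edges are allowed.
  An infinite capacity is the value \<open>\<infinity>\<close> of type \<open>enat\<close>.
\<close>

record ('v, 'e) lsp_instance =
  lside :: "'v set"
  rside :: "'v set"
  edges :: "'e set"
  lend :: "'e \<Rightarrow> 'v"
  rend :: "'e \<Rightarrow> 'v"
  capacity :: "'v \<Rightarrow> enat"
  budget :: "'e \<Rightarrow> real"

definition lsp_wf :: "('v, 'e) lsp_instance \<Rightarrow> bool" where
  "lsp_wf I \<longleftrightarrow>
     finite (lside I) \<and> finite (rside I) \<and> lside I \<inter> rside I = {} \<and> finite (edges I) \<and>
     (\<forall>e\<in>edges I. lend I e \<in> lside I \<and> rend I e \<in> rside I \<and> 0 \<le> budget I e)"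

definition incident :: "('v, 'e) lsp_instance \<Rightarrow> 'e \<Rightarrow> 'v \<Rightarrow> bool" where
  "incident I e w \<longleftrightarrow> w = lend I e \<or> w = rend I e"

definition price_set :: "('v, 'e) lsp_instance \<Rightarrow> 'v \<Rightarrow> real set" where
  "price_set I u = budget I ` {e \<in> edges I. incident I e u}"

text \<open>
  A pricing is stored already extended by 0 to \<open>R\<close> (and to the elements of the vertex type that
  are not vertices). If some vertex of \<open>L\<close> is isolated, no pricing exists.
\<close>

definition pricing :: "('v, 'e) lsp_instance \<Rightarrow> ('v \<Rightarrow> real) \<Rightarrow> bool" where
  "pricing I p \<longleftrightarrow> (\<forall>u\<in>lside I. p u \<in> price_set I u) \<and> (\<forall>w. w \<notin> lside I \<longrightarrow> p w = 0)"

definition edge_price :: "('v, 'e) lsp_instance \<Rightarrow> ('v \<Rightarrow> real) \<Rightarrow> 'e \<Rightarrow> real" where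
  "edge_price I p e = p (lend I e) + p (rend I e)"

definition feasible :: "('v, 'e) lsp_instance \<Rightarrow> ('v \<Rightarrow> real) \<Rightarrow> 'e set \<Rightarrow> bool" where
  "feasible I p F \<longleftrightarrow>
     F \<subseteq> edges I \<and>
     (\<forall>e\<in>F. edge_price I p e \<le> budget I e) \<and>
     (\<forall>w \<in> lside I \<union> rside I. enat (card {e \<in> F. incident I e w}) \<le> capacity I w)"

definition val :: "('v, 'e) lsp_instance \<Rightarrow> ('v \<Rightarrow> real) \<Rightarrow> real" where
  "val I p = Max ((\<lambda>F. \<Sum>e\<in>F. edge_price I p e) ` {F. feasible I p F})"

text \<open>The maximum in the definition of \<open>val\<close> ranges over a finite nonempty set.\<close>

lemma finite_feasible: "lsp_wf I \<Longrightarrow> finite {F. feasible I p F}"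
  by (rule finite_subset[of _ "Pow (edges I)"]) (auto simp: feasible_def lsp_wf_def)

lemma feasible_empty: "feasible I p {}"
  by (simp add: feasible_def flip: zero_enat_def)

definition optimal_pricing :: "('v, 'e) lsp_instance \<Rightarrow> ('v \<Rightarrow> real) \<Rightarrow> bool" where
  "optimal_pricing I p \<longleftrightarrow> pricing I p \<and> (\<forall>q. pricing I q \<longrightarrow> val I q \<le> val I p)"

definition HW :: "('v, 'e) lsp_instance \<Rightarrow> ('v \<Rightarrow> real) \<Rightarrow> ('v \<Rightarrow> real) \<Rightarrow> nat" where
  "HW I p q = card {u \<in> lside I. p u \<noteq> q u}"

definition locally_optimal_pricing :: "('v, 'e) lsp_instance \<Rightarrow> ('v \<Rightarrow> real) \<Rightarrow> bool" where
  "locally_optimal_pricing I p \<longleftrightarrow>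
     pricing I p \<and> (\<forall>q. pricing I q \<and> HW I p q = 1 \<longrightarrow> val I q \<le> val I p)"

end

theory Submission
  imports Defs
begin

text \<open>
  Let \<open>F\<close> and \<open>G\<close> attain \<open>val p\<close> and \<open>val p\<^sup>*\<close>. At every \<open>v \<in> R\<close> match as many edges of \<open>G\<close> as
  possible injectively with edges of \<open>F\<close>. When the price of a single \<open>u\<close> is changed to \<open>p\<^sup>* u\<close>,
  replace the edges of \<open>F\<close> at \<open>u\<close> by those of \<open>G\<close> at \<open>u\<close> and drop the partners in \<open>F\<close> of the
  latter; this respects all capacities. Local optimality bounds the gain at \<open>u\<close> by the loss at \<open>u\<close>.
  Summed over \<open>u\<close>, the gain is \<open>val p\<^sup>*\<close>, and the loss is at most \<open>2 val p\<close>, since every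
  edge of \<open>F\<close> is lost at most once as an edge at \<open>u\<close> and at most once as a partner.
\<close>

text \<open>The smaller of the two sets injects into the larger. If that injection goes from
  \<open>A\<close> into \<open>B\<close>, its inverse on the image serves as \<open>g\<close> and
  hits all of \<open>A\<close>.\<close>

lemma maximal_partial_injection:
  assumes "finite A" "finite B"
  shows "\<exists>S g. S \<subseteq> B \<and> inj_on g S \<and> g ` S \<subseteq> A \<and> (S = B \<or> g ` S = A)"
proof (cases "card B \<le> card A")
  case True
  then obtain g where "g ` B \<subseteq> A" "inj_on g B"
    using card_le_inj[OF assms(2,1)] by blast
  then show ?thesis by blast
next
  case False
  then obtain f where f: "f ` A \<subseteq> B" "inj_on f A"
    using card_le_inj[OF assms] by (meson nat_le_linear)
  have "inj_on (inv_into A f) (f ` A)" by (rule inj_on_inv_into) simp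
  moreover have "inv_into A f ` (f ` A) = A" using f(2) by simp
  ultimately show ?thesis using f(1) by blast
qed

text \<open>Maximal matchings chosen separately on the fibres of \<open>r\<close> are glued
  together. Matched elements share a fibre and distinct fibres are disjoint, so injectivity
  survives. Which side is exhausted may vary from fibre to fibre.\<close>

lemma maximal_fibrewise_partial_injection:
  assumes "finite A" "finite B"
  obtains S g where "S \<subseteq> B" "inj_on g S" "g ` S \<subseteq> A" "\<And>e. e \<in> S \<Longrightarrow> r (g e) = r e"
    "\<And>v. {e \<in> B. r e = v} \<subseteq> S \<or> {e \<in> A. r e = v} \<subseteq> g ` S"
proof -
  have "\<forall>v. \<exists>S g. S \<subseteq> {e \<in> B. r e = v} \<and> inj_on g S \<and> g ` S \<subseteq> {e \<in> A. r e = v} \<and>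
      (S = {e \<in> B. r e = v} \<or> g ` S = {e \<in> A. r e = v})"
    using assms by (intro allI maximal_partial_injection) auto
  from choice[OF this] obtain T where
    "\<forall>v. \<exists>g. T v \<subseteq> {e \<in> B. r e = v} \<and> inj_on g (T v) \<and> g ` T v \<subseteq> {e \<in> A. r e = v} \<and>
      (T v = {e \<in> B. r e = v} \<or> g ` T v = {e \<in> A. r e = v})" ..
  from choice[OF this] obtain h where
    "\<forall>v. T v \<subseteq> {e \<in> B. r e = v} \<and> inj_on (h v) (T v) \<and> h v ` T v \<subseteq> {e \<in> A. r e = v} \<and>
      (T v = {e \<in> B. r e = v} \<or> h v ` T v = {e \<in> A. r e = v})" ..
  then have T: "\<And>v. T v \<subseteq> {e \<in> B. r e = v}" and inj: "\<And>v. inj_on (h v) (T v)"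
    and h: "\<And>v. h v ` T v \<subseteq> {e \<in> A. r e = v}"
    and max: "\<And>v. T v = {e \<in> B. r e = v} \<or> h v ` T v = {e \<in> A. r e = v}"
    by simp_all
  \<comment> \<open>Each element consults only the matching of its own fibre.\<close>
  define S where "S = {e. e \<in> T (r e)}"
  define g where "g e = h (r e) e" for e
  have rg: "g e \<in> A \<and> r (g e) = r e" if "e \<in> S" for e
    using that h[of "r e"] by (auto simp: S_def g_def)
  have T_S: "T v \<subseteq> S" for v using T[of v] by (auto simp: S_def)
  have h_g: "h v ` T v \<subseteq> g ` S" for v
  proof
    fix x assume "x \<in> h v ` T v"
    then obtain e where "e \<in> T v" "x = h v e" by blast
    moreover from this have "r e = v" using T by blast
    ultimately show "x \<in> g ` S" using T_S by (auto simp: g_def)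
  qed
  show thesis
  proof
    show "S \<subseteq> B" using T by (auto simp: S_def)
    show "inj_on g S"
    proof (rule inj_onI)
      fix x y assume *: "x \<in> S" "y \<in> S" "g x = g y"
      then have "r x = r y" using rg by metis
      with * show "x = y" using inj[of "r x"] by (auto simp: S_def g_def dest: inj_onD)
    qed
    show "g ` S \<subseteq> A" using rg by blast
    show "r (g e) = r e" if "e \<in> S" for e using rg that by blast
    show "{e \<in> B. r e = v} \<subseteq> S \<or> {e \<in> A. r e = v} \<subseteq> g ` S" for v
      using max[of v] T_S[of v] h_g[of v] by auto
  qed
qed

text \<open>This is the capacity count at one right vertex, with \<open>C\<close> inserted and its
  partners removed. If all of \<open>B\<close> is matched, every inserted element evicts its own
  partner, so the size stays \<open>card A\<close>. If all of \<open>A\<close> is matched, the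
  survivors are partners of elements of \<open>B - C\<close>, so with \<open>C\<close> they number
  at most \<open>card B\<close>.\<close>

lemma card_exchange_le_max:
  assumes fin: "finite A" "finite B" and C: "C \<subseteq> B"
    and inj: "inj_on g S" and g: "g ` (S \<inter> B) \<subseteq> A"
    and max: "B \<subseteq> S \<or> A \<subseteq> g ` (S \<inter> B)"
  shows "card (A - g ` (S \<inter> C)) + card C \<le> max (card A) (card B)"
  using max
proof
  assume "B \<subseteq> S"
  then have "S \<inter> C = C" "C \<subseteq> S" using C by auto
  moreover from this have "card (g ` C) = card C" using inj by (meson card_image inj_on_subset)
  moreover have "g ` C \<subseteq> A" using g C \<open>S \<inter> C = C\<close> by blast
  ultimately have "card (A - g ` (S \<inter> C)) + card C = card A"
    using fin C by (metis card_Diff_subset card_mono finite_subset le_add_diff_inverse2)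
  then show ?thesis by simp
next
  assume "A \<subseteq> g ` (S \<inter> B)"
  then have "A - g ` (S \<inter> C) \<subseteq> g ` (B - C)" by auto
  then have "card (A - g ` (S \<inter> C)) \<le> card (g ` (B - C))" using fin by (intro card_mono) auto
  also have "\<dots> \<le> card (B - C)" using fin by (intro card_image_le) auto
  finally have "card (A - g ` (S \<inter> C)) + card C \<le> card B"
    using fin C by (metis add_le_mono1 card_Diff_subset card_mono finite_subset
        le_add_diff_inverse2)
  then show ?thesis by simp
qed

lemma val_attained:
  assumes "lsp_wf I"
  obtains F where "feasible I p F" "val I p = (\<Sum>e\<in>F. edge_price I p e)"
proof -
  have "val I p \<in> (\<lambda>F. \<Sum>e\<in>F. edge_price I p e) ` {F. feasible I p F}"
    unfolding val_def using finite_feasible[OF assms] feasible_empty by (intro Max_in) auto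
  then show thesis using that by auto
qed

lemma feasible_le_val:
  assumes "lsp_wf I" "feasible I p F"
  shows "(\<Sum>e\<in>F. edge_price I p e) \<le> val I p"
  unfolding val_def using finite_feasible[OF assms(1)] assms(2) by (intro Max_ge) auto

lemma edge_price_pricing:
  assumes "lsp_wf I" "pricing I p" "e \<in> edges I"
  shows "edge_price I p e = p (lend I e)"
  using assms by (auto simp: edge_price_def pricing_def lsp_wf_def)

lemma pricing_nonneg:
  assumes "lsp_wf I" "pricing I p"
  shows "0 \<le> p u"
proof (cases "u \<in> lside I")
  case True
  then have "p u \<in> price_set I u" using assms(2) by (auto simp: pricing_def)
  then show ?thesis using assms(1) by (auto simp: price_set_def lsp_wf_def)
qed (use assms(2) in \<open>simp add: pricing_def\<close>)

lemma pricing_fun_upd: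
  assumes "pricing I p" "pricing I q" "u \<in> lside I"
  shows "pricing I (p(u := q u))"
  using assms by (auto simp: pricing_def)

lemma locally_optimal_val_fun_upd_le:
  assumes "locally_optimal_pricing I p" "pricing I q" "u \<in> lside I"
  shows "val I (p(u := q u)) \<le> val I p"
\<comment> \<open>Local optimality only compares pricings at distance exactly 1, so an unchanged
  price is treated apart.\<close>
proof (cases "q u = p u")
  case True
  then have "p(u := q u) = p" by auto
  then show ?thesis by simp
next
  case False
  then have "{w \<in> lside I. p w \<noteq> (p(u := q u)) w} = {u}" using assms(3) by auto
  then have "HW I p (p(u := q u)) = 1" by (simp add: HW_def)
  then show ?thesis
    using assms pricing_fun_upd[of I p q u] by (auto simp: locally_optimal_pricing_def)
qed

text \<open>The two sides are disjoint, so a vertex meets edges through one kind of endpoint only,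
  and right endpoints have price 0. The capacities of the two sides can then be checked by different
  arguments.\<close>

lemma feasible_iff:
  assumes "lsp_wf I" "pricing I p"
  shows "feasible I p F \<longleftrightarrow> F \<subseteq> edges I \<and> (\<forall>e\<in>F. p (lend I e) \<le> budget I e) \<and>
    (\<forall>w\<in>lside I. enat (card {e \<in> F. lend I e = w}) \<le> capacity I w) \<and>
    (\<forall>w\<in>rside I. enat (card {e \<in> F. rend I e = w}) \<le> capacity I w)"
proof (cases "F \<subseteq> edges I")
  case True
  have "{e \<in> F. incident I e w} = {e \<in> F. lend I e = w}" if "w \<in> lside I" for w
    using that True assms(1) by (auto simp: incident_def lsp_wf_def)
  moreover have "{e \<in> F. incident I e w} = {e \<in> F. rend I e = w}" if "w \<in> rside I" for w
    using that True assms(1) by (auto simp: incident_def lsp_wf_def)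
  moreover have "\<forall>e\<in>F. edge_price I p e = p (lend I e)"
    using True edge_price_pricing[OF assms] by blast
  ultimately show ?thesis using True by (simp add: feasible_def ball_Un)
qed (simp add: feasible_def)

text \<open>On the left, \<open>u\<close> carries exactly its edges of \<open>G\<close>, and any
  other vertex carries a subset of its edges of \<open>F\<close>. On the right, the load is at most
  the larger of the loads under \<open>F\<close> and \<open>G\<close>, both of which respect the
  capacity.\<close>

lemma feasible_exchange:
  assumes wf: "lsp_wf I" and p: "pricing I p" and q: "pricing I q" and u: "u \<in> lside I"
    and F: "feasible I p F" and G: "feasible I q G"
    and S: "S \<subseteq> G" "inj_on g S" "g ` S \<subseteq> F" "\<And>e. e \<in> S \<Longrightarrow> rend I (g e) = rend I e"
    and max: "\<And>v. {e \<in> G. rend I e = v} \<subseteq> S \<or> {e \<in> F. rend I e = v} \<subseteq> g ` S"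
  shows "feasible I (p(u := q u))
    ({e \<in> F - g ` {e \<in> S. lend I e = u}. lend I e \<noteq> u} \<union> {e \<in> G. lend I e = u})"
    (is "feasible I _ (?X \<union> ?Y)")
proof -
  note F' = F[unfolded feasible_iff[OF wf p]] and G' = G[unfolded feasible_iff[OF wf q]]
  have fin: "finite F" "finite G"
    using F' G' wf by (auto simp: lsp_wf_def intro: finite_subset)
  have "enat (card {e \<in> ?X \<union> ?Y. lend I e = w}) \<le> capacity I w" if w: "w \<in> lside I" for w
  proof (cases "w = u")
    case True
    then have "{e \<in> ?X \<union> ?Y. lend I e = w} = {e \<in> G. lend I e = w}" by auto
    then show ?thesis using G' w by simp
  next
    case False
    then have "card {e \<in> ?X \<union> ?Y. lend I e = w} \<le> card {e \<in> F. lend I e = w}"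
      using fin by (intro card_mono) auto
    then show ?thesis using F' w by (meson enat_ord_simps(1) order_trans)
  qed
  moreover have "enat (card {e \<in> ?X \<union> ?Y. rend I e = w}) \<le> capacity I w"
    if w: "w \<in> rside I" for w
  proof -
    let ?A = "{e \<in> F. rend I e = w}" and ?B = "{e \<in> G. rend I e = w}"
    let ?C = "{e \<in> ?B. lend I e = u}"
    \<comment> \<open>Only an inclusion, because \<open>?X\<close> also lacks the edges of
      \<open>F\<close> at \<open>u\<close>.\<close>
    have "{e \<in> ?X \<union> ?Y. rend I e = w} \<subseteq> (?A - g ` (S \<inter> ?C)) \<union> ?C" by auto
    then have "card {e \<in> ?X \<union> ?Y. rend I e = w} \<le> card ((?A - g ` (S \<inter> ?C)) \<union> ?C)"
      using fin by (intro card_mono) auto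
    also have "\<dots> \<le> card (?A - g ` (S \<inter> ?C)) + card ?C" by (rule card_Un_le)
    also have "\<dots> \<le> max (card ?A) (card ?B)"
    proof (rule card_exchange_le_max)
      show "g ` (S \<inter> ?B) \<subseteq> ?A" using S(3,4) by auto
      \<comment> \<open>Since \<open>g\<close> keeps right endpoints, edges at \<open>w\<close> can
        only be partners of edges at \<open>w\<close>.\<close>
      have "?A \<subseteq> g ` (S \<inter> ?B)" if "?A \<subseteq> g ` S"
      proof
        fix x assume x: "x \<in> ?A"
        with that obtain e where "e \<in> S" "x = g e" by blast
        with x S(1,4) show "x \<in> g ` (S \<inter> ?B)" by auto
      qed
      then show "?B \<subseteq> S \<or> ?A \<subseteq> g ` (S \<inter> ?B)" using max by blast
    qed (use fin S(2) in auto)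
    finally have "enat (card {e \<in> ?X \<union> ?Y. rend I e = w}) \<le> max (enat (card ?A)) (enat (card ?B))"
      by (simp add: le_max_iff_disj)
    also have "\<dots> \<le> capacity I w" using F' G' w by (simp add: max_def)
    finally show ?thesis .
  qed
  ultimately show ?thesis
    unfolding feasible_iff[OF wf pricing_fun_upd[OF p q u]] using F' G' by auto
qed

lemma sum_le_sum_Un3:
  fixes f :: "'a \<Rightarrow> real"
  assumes "finite X" "finite Y" "finite Z" "F \<subseteq> X \<union> Y \<union> Z" "\<And>x. 0 \<le> f x"
  shows "sum f F \<le> sum f X + sum f Y + sum f Z"
proof -
  have Un: "sum f (A \<union> B) \<le> sum f A + sum f B" if "finite A" "finite B" for A B
    using that assms(5) by (simp add: sum_Un sum_nonneg)
  have "sum f F \<le> sum f (X \<union> Y \<union> Z)" using assms by (intro sum_mono2) auto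
  also have "\<dots> \<le> sum f (X \<union> Y) + sum f Z" using assms by (intro Un) auto
  also have "\<dots> \<le> sum f X + sum f Y + sum f Z" using assms Un by auto
  finally show ?thesis .
qed

lemma local_gain_le_loss:
  assumes wf: "lsp_wf I" and p: "locally_optimal_pricing I p" and q: "pricing I q"
    and u: "u \<in> lside I"
    and F: "feasible I p F" and G: "feasible I q G"
    and val: "val I p = (\<Sum>e\<in>F. p (lend I e))"
    and S: "S \<subseteq> G" "inj_on g S" "g ` S \<subseteq> F" "\<And>e. e \<in> S \<Longrightarrow> rend I (g e) = rend I e"
    and max: "\<And>v. {e \<in> G. rend I e = v} \<subseteq> S \<or> {e \<in> F. rend I e = v} \<subseteq> g ` S"
  shows "(\<Sum>e | e \<in> G \<and> lend I e = u. q (lend I e)) \<le>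
    (\<Sum>e | e \<in> F \<and> lend I e = u. p (lend I e)) +
    (\<Sum>e | e \<in> S \<and> lend I e = u. p (lend I (g e)))"
proof -
  let ?D = "g ` {e \<in> S. lend I e = u}"
  let ?X = "{e \<in> F - ?D. lend I e \<noteq> u}" and ?Y = "{e \<in> G. lend I e = u}"
  let ?p = "p(u := q u)"
  have pp: "pricing I p" using p by (simp add: locally_optimal_pricing_def)
  have sub: "F \<subseteq> edges I" "G \<subseteq> edges I" using F G by (auto simp: feasible_def)
  have fin: "finite F" "finite G" "finite S"
    using sub S(1) wf by (auto simp: lsp_wf_def intro: finite_subset)
  have "(\<Sum>e\<in>?X. p (lend I e)) + (\<Sum>e\<in>?Y. q (lend I e)) =
      (\<Sum>e\<in>?X. edge_price I ?p e) + (\<Sum>e\<in>?Y. edge_price I ?p e)"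
    using sub edge_price_pricing[OF wf pricing_fun_upd[OF pp q u]]
    by (intro arg_cong2[where f = "(+)"] sum.cong) auto
  also have "\<dots> = (\<Sum>e\<in>?X \<union> ?Y. edge_price I ?p e)"
    using fin by (intro sum.union_disjoint[symmetric]) auto
  also have "\<dots> \<le> val I ?p"
    by (intro feasible_le_val wf feasible_exchange pp q u F G S max)
  also have "\<dots> \<le> val I p"
    by (rule locally_optimal_val_fun_upd_le[OF p q u])
  \<comment> \<open>A partner may itself lie at \<open>u\<close>, so the last two sums can overlap;
    nonnegative prices make this harmless. The sum over \<open>?X\<close> occurs at both ends of the
    chain and cancels.\<close>
  also have "\<dots> \<le> (\<Sum>e\<in>?X. p (lend I e)) + (\<Sum>e | e \<in> F \<and> lend I e = u. p (lend I e)) +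
      (\<Sum>e\<in>?D. p (lend I e))"
    unfolding val using fin pricing_nonneg[OF wf pp] by (intro sum_le_sum_Un3) auto
  \<comment> \<open>Indexing the loss by the matched edge of \<open>G\<close> instead of its partner
    lets it be grouped by left endpoint when summing over \<open>u\<close>.\<close>
  also have "(\<Sum>e\<in>?D. p (lend I e)) = (\<Sum>e | e \<in> S \<and> lend I e = u. p (lend I (g e)))"
    by (rule sum.reindex_cong[where l = g]) (auto intro: inj_on_subset[OF S(2)])
  finally show ?thesis by simp
qed

theorem theorem9:
  fixes I :: "('v, 'e) lsp_instance" and p pstar :: "'v \<Rightarrow> real"
  assumes "lsp_wf I"
    and "optimal_pricing I pstar"
    and "locally_optimal_pricing I p"
  shows "val I p \<ge> val I pstar / 2"
proof -
  note wf = assms(1)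
  have p: "pricing I p" and q: "pricing I pstar"
    using assms by (auto simp: locally_optimal_pricing_def optimal_pricing_def)
  obtain F where F: "feasible I p F" "val I p = (\<Sum>e\<in>F. edge_price I p e)"
    using val_attained[OF wf] .
  obtain G where G: "feasible I pstar G" "val I pstar = (\<Sum>e\<in>G. edge_price I pstar e)"
    using val_attained[OF wf] .
  have sub: "F \<subseteq> edges I" "G \<subseteq> edges I" using F G by (auto simp: feasible_def)
  have valF: "val I p = (\<Sum>e\<in>F. p (lend I e))"
    unfolding F(2) using sub edge_price_pricing[OF wf p] by (intro sum.cong) auto
  have valG: "val I pstar = (\<Sum>e\<in>G. pstar (lend I e))"
    unfolding G(2) using sub edge_price_pricing[OF wf q] by (intro sum.cong) auto
  have fin: "finite F" "finite G" "finite (lside I)"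
    using sub wf by (auto simp: lsp_wf_def intro: finite_subset)
  obtain S g where S: "S \<subseteq> G" "inj_on g S" "g ` S \<subseteq> F" "\<And>e. e \<in> S \<Longrightarrow> rend I (g e) = rend I e"
    and max: "\<And>v. {e \<in> G. rend I e = v} \<subseteq> S \<or> {e \<in> F. rend I e = v} \<subseteq> g ` S"
    by (rule maximal_fibrewise_partial_injection[OF fin(1,2), where r = "rend I"]) blast
  have finS: "finite S" using S(1) fin(2) by (rule finite_subset)
  have subS: "S \<subseteq> edges I" using S(1) sub(2) by (rule subset_trans)
  have group: "(\<Sum>u\<in>lside I. \<Sum>e | e \<in> A \<and> lend I e = u. f e) = sum f A"
    if "finite A" "A \<subseteq> edges I" for A and f :: "'e \<Rightarrow> real"
    using that fin(3) wf by (intro sum.group) (auto simp: lsp_wf_def)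
  have "val I pstar = (\<Sum>u\<in>lside I. \<Sum>e | e \<in> G \<and> lend I e = u. pstar (lend I e))"
    unfolding valG by (rule group[OF fin(2) sub(2), symmetric])
  also have "\<dots> \<le> (\<Sum>u\<in>lside I. (\<Sum>e | e \<in> F \<and> lend I e = u. p (lend I e)) +
      (\<Sum>e | e \<in> S \<and> lend I e = u. p (lend I (g e))))"
    by (intro sum_mono local_gain_le_loss[OF wf assms(3) q _ F(1) G(1) valF S max])
  also have "\<dots> = (\<Sum>e\<in>F. p (lend I e)) + (\<Sum>e\<in>S. p (lend I (g e)))"
    by (simp only: sum.distrib group[OF fin(1) sub(1)] group[OF finS subS])
  \<comment> \<open>Injectivity of \<open>g\<close> ensures that no edge of \<open>F\<close> is
    charged twice as a partner.\<close>
  also have "(\<Sum>e\<in>S. p (lend I (g e))) = (\<Sum>e\<in>g ` S. p (lend I e))"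
    using S(2) by (simp add: sum.reindex)
  also have "\<dots> \<le> (\<Sum>e\<in>F. p (lend I e))"
    using S(3) fin pricing_nonneg[OF wf p] by (intro sum_mono2) auto
  finally show ?thesis using valF by simp
qed

end
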